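(* Let $m<n$ be positive integers, $A\in\mathbb{R}^{m\times n}$, $b\in\mathbb{R}^m$, $c\in\mathbb{R}^n$, and consider the linear program $$\min\ c^{\top}x\quad\text{subject to}\quad Ax=b,\ x\ge 0 .$$ Assume that (i) $\operatorname{rank}A=m$; (ii) this problem and its dual $\max\{b^{\top}y : A^{\top}y+s=c,\ s\ge 0\}$ have optimal basic solutions $x^*$ and $(y^*,s^* )$, respectively, with optimal value $z^*$; (iii) an initial basic feasible solution (BFS) $x^0$ is available and it is not optimal, that is, $c^{\top}x^0>z^*$. Let $\gamma$ and $\delta$ be the maximum and minimum positive elements, respectively, in all BFSs, let $\beta=\min_{j}\|a_j\|/\max_{j}\|a_j\|$, where $a_j$ is the $j$-th column of $A$ and $j$ ranges over $\{1,\dots,n\}$, and let $\bar{x}$ be a BFS of the problem with the second smallest objective value. Then, for this problem, the simplex method with the largest distance rule, started from $x^0$, generates at most $$\left\lceil \frac{m\gamma}{\beta\delta}\,\log\left(\frac{c^{\top}x^0-z^*}{c^{\top}\bar{x}-z^*}\right)\right\rceil$$ different BFSs.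
   Context: Notation: $\|\cdot\|$ is the Euclidean norm, $\log$ is the natural logarithm, and for a real number $r$, $\lceil r\rceil$ denotes the minimum integer greater than $r$. Bases and dictionaries: a set $B\subset\{1,\dots,n\}$ with $|B|=m$ and $A_B$ (the columns of $A$ indexed by $B$) nonsingular is a basis, and $N=\{1,\dots,n\}\setminus B$ is the corresponding nonbasis. The dictionary for $B$ is: minimize $c_B^{\top}A_B^{-1}b+\bar{c}_N^{\top}x_N$ subject to $x_B=A_B^{-1}b-\bar{A}_Nx_N$, $x=(x_B,x_N)\ge0$, where $\bar{c}_N=c_N-A_N^{\top}(A_B^{\top})^{-1}c_B$ is the reduced cost vector and $\bar{A}_N=A_B^{-1}A_N$ is the nonbasic matrix. The basic solution of $B$ is $(x_B,x_N)=(A_B^{-1}b,0)$; it is a basic feasible solution (BFS) if $x_B\ge0$, in which case $B$ is called a feasible basis. Simplex method: starting from a feasible basis whose BFS is $x^0$, at iteration $t$ with basis $B^t$, nonbasis $N^t$ and BFS $x^t$: if $\bar{c}_{N^t}\ge0$, then $x^t$ is optimal. Otherwise choose, by the pivoting rule, a nonbasic variable $x_j$, $j\in N^t$, with $\bar{c}_j<0$ (the entering variable) and increase it from $0$, keeping the other nonbasic variables at $0$. If it can be increased infinitely without violating the constraints, the problem is unbounded and the algorithm stops; otherwise some basic variable $x_i$ (the leaving variable) becomes zero at some point, and the roles of $x_i$ and $x_j$ are exchanged, giving a new dictionary and the next BFS $x^{t+1}$. No nondegeneracy assumption is made, so $x^{t+1}=x^t$ is possible. Largest distance rule: the entering index is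 some $j\in\arg\min\{\bar{c}_j/\|a_j\| : j\in N^t\}$, where $a_j$ is the $j$-th column of the constraint matrix $A$ (not of $\bar{A}_N$). Parameters: $\delta$ (resp. $\gamma$) is the minimum (resp. maximum) of all positive elements occurring in any BFS of the problem. A BFS with the second smallest objective value is a BFS whose objective value is the second smallest among the objective values of all BFSs, the smallest being $z^*$.
   Formalization: The bound counts the different BFSs other than the initial x^0 (counting x^0 it fails: min x_1, x_1+x_2=1, x≥0, x^0=(1,0) has bound 1 but two BFSs occur); all columns a_j are assumed nonzero, as the rule and the bound divide by column norms and by β. *)

theory Defs
  imports "HOL-Analysis.Analysis"
begin

text \<open>The linear program: minimize \<open>c \<bullet> x\<close> subject to \<open>A *v x = b\<close>, \<open>x \<ge> 0\<close>, with \<open>m = CARD('m)\<close>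
  constraints and \<open>n = CARD('n)\<close> variables. The order on vectors is componentwise.\<close>

definition primal_feasible :: "real^'n^'m \<Rightarrow> real^'m \<Rightarrow> real^'n \<Rightarrow> bool" where
  "primal_feasible A b x \<longleftrightarrow> A *v x = b \<and> 0 \<le> x"

definition primal_optimal :: "real^'n^'m \<Rightarrow> real^'m \<Rightarrow> real^'n \<Rightarrow> real^'n \<Rightarrow> bool" where
  "primal_optimal A b c x \<longleftrightarrow>
     primal_feasible A b x \<and> (\<forall>x'. primal_feasible A b x' \<longrightarrow> c \<bullet> x \<le> c \<bullet> x')"

definition dual_feasible :: "real^'n^'m \<Rightarrow> real^'n \<Rightarrow> real^'m \<Rightarrow> real^'n \<Rightarrow> bool" where
  "dual_feasible A c y s \<longleftrightarrow> transpose A *v y + s = c \<and> 0 \<le> s"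

definition dual_optimal :: "real^'n^'m \<Rightarrow> real^'m \<Rightarrow> real^'n \<Rightarrow> real^'m \<Rightarrow> real^'n \<Rightarrow> bool" where
  "dual_optimal A b c y s \<longleftrightarrow>
     dual_feasible A c y s \<and> (\<forall>y' s'. dual_feasible A c y' s' \<longrightarrow> b \<bullet> y' \<le> b \<bullet> y)"

text \<open>To form the square matrix \<open>A\<^sub>B\<close> the elements of \<open>B\<close> are listed, in an arbitrary order, by
  the row index type. All notions below that involve a basis are independent of this order.\<close>

definition enum :: "'n set \<Rightarrow> 'm \<Rightarrow> 'n" where
  "enum B = (SOME f. bij_betw f UNIV B)"

definition basis_matrix :: "real^'n^'m \<Rightarrow> 'n set \<Rightarrow> real^'m^'m" where
  "basis_matrix A B = (\<chi> i k. A $ i $ enum B k)"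

definition basis_cost :: "real^'n \<Rightarrow> 'n set \<Rightarrow> real^'m" where
  "basis_cost c B = (\<chi> k. c $ enum B k)"

text \<open>The vector indexed by all variables whose \<open>B\<close>-part is \<open>v\<close> and whose nonbasic part is 0.\<close>

definition extend :: "'n set \<Rightarrow> real^'m \<Rightarrow> real^'n" where
  "extend B v = (\<chi> j. if j \<in> B then v $ (inv (enum B) j) else 0)"

definition is_basis :: "real^'n^'m \<Rightarrow> 'n set \<Rightarrow> bool" where
  "is_basis A B \<longleftrightarrow> card B = CARD('m) \<and> invertible (basis_matrix A B)"

definition basic_solution :: "real^'n^'m \<Rightarrow> real^'m \<Rightarrow> 'n set \<Rightarrow> real^'n" where
  "basic_solution A b B = extend B (matrix_inv (basis_matrix A B) *v b)"

definition feasible_basis :: "real^'n^'m \<Rightarrow> real^'m \<Rightarrow> 'n set \<Rightarrow> bool" where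
  "feasible_basis A b B \<longleftrightarrow> is_basis A B \<and> 0 \<le> basic_solution A b B"

definition is_BFS :: "real^'n^'m \<Rightarrow> real^'m \<Rightarrow> real^'n \<Rightarrow> bool" where
  "is_BFS A b x \<longleftrightarrow> (\<exists>B. feasible_basis A b B \<and> x = basic_solution A b B)"

definition dual_vector :: "real^'n^'m \<Rightarrow> real^'n \<Rightarrow> 'n set \<Rightarrow> real^'m" where
  "dual_vector A c B = matrix_inv (transpose (basis_matrix A B)) *v basis_cost c B"

text \<open>The reduced cost vector is extended to all indices; its basic components are 0.\<close>

definition reduced_cost :: "real^'n^'m \<Rightarrow> real^'n \<Rightarrow> 'n set \<Rightarrow> real^'n" where
  "reduced_cost A c B = c - transpose A *v dual_vector A c B"

definition is_dual_basic_solution :: "real^'n^'m \<Rightarrow> real^'n \<Rightarrow> real^'m \<Rightarrow> real^'n \<Rightarrow> bool" where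
  "is_dual_basic_solution A c y s \<longleftrightarrow>
     (\<exists>B. is_basis A B \<and> y = dual_vector A c B \<and> s = reduced_cost A c B)"

text \<open>The point obtained by giving the nonbasic variable \<open>j\<close> the value \<open>\<theta>\<close>, keeping the other
  nonbasic variables at 0 and setting \<open>x\<^sub>B\<close> according to the dictionary of \<open>B\<close>.\<close>

definition increase :: "real^'n^'m \<Rightarrow> real^'m \<Rightarrow> 'n set \<Rightarrow> 'n \<Rightarrow> real \<Rightarrow> real^'n" where
  "increase A b B j \<theta> =
     extend B (matrix_inv (basis_matrix A B) *v b
                 - \<theta> *\<^sub>R (matrix_inv (basis_matrix A B) *v column j A))
     + \<theta> *\<^sub>R axis j 1"

text \<open>The largest distance rule; ties are broken arbitrarily.\<close>

definition entering :: "real^'n^'m \<Rightarrow> real^'n \<Rightarrow> 'n set \<Rightarrow> 'n \<Rightarrow> bool" where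
  "entering A c B j \<longleftrightarrow>
     is_arg_min (\<lambda>k. reduced_cost A c B $ k / norm (column k A)) (\<lambda>k. k \<notin> B) j \<and>
     reduced_cost A c B $ j < 0"

text \<open>A basic variable \<open>i\<close> leaves if it blocks the increase of the entering variable \<open>j\<close>: it vanishes
  at the last feasible point \<open>\<theta>\<close> and becomes negative beyond it. Requiring only that it vanishes
  at \<open>\<theta>\<close> would allow, at a degenerate vertex, variables whose exchange with \<open>j\<close> is not a valid
  pivot. No variable can leave if \<open>j\<close> can be increased without bound.\<close>

definition leaving :: "real^'n^'m \<Rightarrow> real^'m \<Rightarrow> 'n set \<Rightarrow> 'n \<Rightarrow> 'n \<Rightarrow> bool" where
  "leaving A b B j i \<longleftrightarrow> i \<in> B \<and>
     (\<exists>\<theta>\<ge>0. 0 \<le> increase A b B j \<theta> \<and> increase A b B j \<theta> $ i = 0 \<and>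
            (\<forall>\<theta>'>\<theta>. increase A b B j \<theta>' $ i < 0))"

definition pivot :: "real^'n^'m \<Rightarrow> real^'m \<Rightarrow> real^'n \<Rightarrow> 'n set \<Rightarrow> 'n set \<Rightarrow> bool" where
  "pivot A b c B B' \<longleftrightarrow>
     (\<exists>j i. entering A c B j \<and> leaving A b B j i \<and> B' = insert j (B - {i}))"

text \<open>The bases visited in \<open>T\<close> iterations started from \<open>x0\<close>. The value \<open>T = \<infinity>\<close> is a run that does not
  terminate (cycling is not excluded). Only \<open>Bs t\<close> with \<open>t \<le> T\<close> is meaningful. The run may be
  an initial segment of a longer one.\<close>

definition simplex_run ::
  "real^'n^'m \<Rightarrow> real^'m \<Rightarrow> real^'n \<Rightarrow> real^'n \<Rightarrow> (nat \<Rightarrow> 'n set) \<Rightarrow> enat \<Rightarrow> bool" where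
  "simplex_run A b c x0 Bs T \<longleftrightarrow>
     feasible_basis A b (Bs 0) \<and> basic_solution A b (Bs 0) = x0 \<and>
     (\<forall>t. enat t < T \<longrightarrow> pivot A b c (Bs t) (Bs (Suc t)))"

text \<open>The solutions generated from \<open>x0\<close>. The given \<open>x0\<close> itself is not counted, not even when a
  degenerate pivot reproduces it. With \<open>x0\<close> counted, the bound would fail for
  minimizing \<open>x\<^sub>1\<close> subject to \<open>x\<^sub>1 + x\<^sub>2 = 1\<close>, \<open>x \<ge> 0\<close> from \<open>(1, 0)\<close>, where it equals 1.\<close>

definition generated_BFSs ::
  "real^'n^'m \<Rightarrow> real^'m \<Rightarrow> real^'n \<Rightarrow> (nat \<Rightarrow> 'n set) \<Rightarrow> enat \<Rightarrow> (real^'n) set" where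
  "generated_BFSs A b x0 Bs T = {basic_solution A b (Bs t) | t. enat t \<le> T} - {x0}"

definition positive_BFS_elements :: "real^'n^'m \<Rightarrow> real^'m \<Rightarrow> real set" where
  "positive_BFS_elements A b = {x $ j | x j. is_BFS A b x \<and> 0 < x $ j}"

definition BFS_values :: "real^'n^'m \<Rightarrow> real^'m \<Rightarrow> real^'n \<Rightarrow> real set" where
  "BFS_values A b c = {c \<bullet> x | x. is_BFS A b x}"

definition second_best_BFS :: "real^'n^'m \<Rightarrow> real^'m \<Rightarrow> real^'n \<Rightarrow> real^'n \<Rightarrow> bool" where
  "second_best_BFS A b c x \<longleftrightarrow>
     is_BFS A b x \<and> c \<bullet> x = Min (BFS_values A b c - {Min (BFS_values A b c)})"

text \<open>The rounding is strict: the minimum integer greater than \<open>r\<close>, also for integral \<open>r\<close>.\<close>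

definition strict_ceiling :: "real \<Rightarrow> int" where
  "strict_ceiling r = (LEAST k. r < of_int k)"

lemma strict_ceiling_eq: "strict_ceiling r = \<lfloor>r\<rfloor> + 1"
  unfolding strict_ceiling_def by (rule Least_equality) linarith+

end

theory Submission
  imports Defs
begin

text \<open>The excess \<open>c \<bullet> x - z\<^sup>*\<close> of the current BFS shrinks by the factor \<open>1 - \<beta>\<delta>/(m\<gamma>)\<close> at every
  iteration that moves to another point. Let \<open>r\<close> be the reduced cost vector of the current basis
  and \<open>\<rho> < 0\<close> the minimum of \<open>r\<^sub>k / \<parallel>a\<^sub>k\<parallel>\<close> over the nonbasic indices. As \<open>r\<close> vanishes on the
  basis, moving from the current BFS to any solution \<open>x\<close> of \<open>Ax = b\<close> changes the cost by exactly
  \<open>r \<bullet> x\<close>. Applied to the optimal BFS, which has at most \<open>m\<close> positive entries, all at most \<open>\<gamma>\<close>,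
  this bounds the excess by \<open>-\<rho> \<cdot> max\<^sub>k \<parallel>a\<^sub>k\<parallel> \<cdot> m\<gamma>\<close> (\<open>excess_le\<close>). In the next BFS, the entering
  variable is the only one that can be positive and have a nonzero reduced cost, and it is at least
  \<open>\<delta>\<close> if the point moves, so the cost drops by at least \<open>-\<rho> \<cdot> min\<^sub>k \<parallel>a\<^sub>k\<parallel> \<cdot> \<delta>\<close>. The quotient of
  the two bounds is \<open>\<beta>\<delta>/(m\<gamma>)\<close> (\<open>pivot_contracts\<close>).

  A point from which the method moves away is not optimal, so its excess is at least that of the
  second best BFS. Geometric decrease therefore allows at most \<open>L\<close> new points before any change of
  the point, where \<open>L\<close> is the real number rounded in the bound; the change itself adds one more point
  (\<open>card_new_points_le\<close>). Iterations that keep the point do no harm, so degeneracy and even cycling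
  among bases are covered.

  That a pivot leads to a feasible basis again rests on a description of bases that does not refer
  to the enumeration of \<open>B\<close>: they are the \<open>m\<close>-element sets that support no nonzero vector of the
  kernel of \<open>A\<close> (\<open>is_basisI\<close>, \<open>supported_kernel_zero\<close>).\<close>

section \<open>Bases and basic solutions\<close>

lemma bij_betw_enum:
  fixes B :: "'n::finite set"
  assumes "card B = CARD('m::finite)"
  shows "bij_betw (enum B :: 'm \<Rightarrow> 'n) UNIV B"
proof -
  have "\<exists>f :: 'm \<Rightarrow> 'n. bij_betw f UNIV B"
    using assms by (intro finite_same_card_bij) auto
  then show ?thesis
    unfolding enum_def by (rule someI_ex)
qed

lemma extend_outside: "j \<notin> B \<Longrightarrow> extend B v $ j = 0"
  by (simp add: extend_def)

lemma extend_add: "extend B (v + w) = extend B v + extend B w"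
  by (simp add: extend_def vec_eq_iff)

lemma extend_scaleR: "extend B (r *\<^sub>R v) = r *\<^sub>R extend B v"
  by (simp add: extend_def vec_eq_iff)

lemma extend_enum:
  fixes v :: "real^'m" and B :: "'n::finite set"
  assumes "card B = CARD('m)"
  shows "extend B v $ enum B k = v $ k"
proof -
  note bij = bij_betw_enum[OF assms]
  have "enum B k \<in> B"
    using bij by (auto simp: bij_betw_def)
  moreover have "inv (enum B) (enum B k) = k"
    using bij by (simp add: bij_betw_def)
  ultimately show ?thesis
    by (simp add: extend_def)
qed

lemma extend_restrict:
  fixes x :: "real^'n" and B :: "'n set"
  assumes "card B = CARD('m)" and "\<And>j. j \<notin> B \<Longrightarrow> x $ j = 0"
  shows "extend B ((\<chi> k. x $ enum B k) :: real^'m) = x"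
proof -
  have "extend B ((\<chi> k. x $ enum B k) :: real^'m) $ j = x $ j" for j
  proof (cases "j \<in> B")
    case True
    then obtain k :: 'm where "j = enum B k"
      using bij_betw_enum[OF assms(1)] by (auto simp: bij_betw_def)
    then show ?thesis
      using extend_enum[OF assms(1), of "(\<chi> k. x $ enum B k) :: real^'m" k] by simp
  qed (simp add: assms(2) extend_outside)
  then show ?thesis
    by (simp add: vec_eq_iff)
qed

lemma mult_extend:
  fixes A :: "real^'n^'m"
  assumes "card B = CARD('m)"
  shows "A *v extend B v = basis_matrix A B *v v"
proof -
  have "(\<Sum>j\<in>UNIV. A $ i $ j * extend B v $ j) = (\<Sum>k\<in>UNIV. A $ i $ enum B k * v $ k)" for i
  proof -
    have "(\<Sum>j\<in>UNIV. A $ i $ j * extend B v $ j) = (\<Sum>j\<in>B. A $ i $ j * extend B v $ j)"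
      by (rule sum.mono_neutral_right) (auto simp: extend_outside)
    also have "\<dots> = (\<Sum>(k::'m)\<in>UNIV. A $ i $ enum B k * extend B v $ enum B k)"
      by (rule sum.reindex_bij_betw[symmetric]) (rule bij_betw_enum[OF assms])
    finally show ?thesis
      by (simp add: extend_enum[OF assms])
  qed
  then show ?thesis
    by (simp add: matrix_vector_mult_def basis_matrix_def vec_eq_iff)
qed

lemma is_basis_card: "is_basis (A :: real^'n^'m) B \<Longrightarrow> card B = CARD('m)"
  by (simp add: is_basis_def)

lemma matrix_inv_left_right:
  fixes M :: "real^'m^'m"
  assumes "invertible M"
  shows "M ** matrix_inv M = mat 1 \<and> matrix_inv M ** M = mat 1"
  using someI_ex[OF assms[unfolded invertible_def]] by (simp add: matrix_inv_def)

lemma basis_matrix_inv: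
  assumes "is_basis A B"
  shows "basis_matrix A B *v (matrix_inv (basis_matrix A B) *v v) = v"
    and "matrix_inv (basis_matrix A B) *v (basis_matrix A B *v v) = v"
  using assms by (auto simp: is_basis_def matrix_vector_mul_assoc matrix_inv_left_right)

lemma mult_basic_solution: "is_basis A B \<Longrightarrow> A *v basic_solution A b B = b"
  by (simp add: basic_solution_def mult_extend is_basis_card basis_matrix_inv)

lemma basic_solution_outside: "j \<notin> B \<Longrightarrow> basic_solution A b B $ j = 0"
  by (simp add: basic_solution_def extend_outside)

lemma basic_solution_unique:
  fixes A :: "real^'n^'m"
  assumes "is_basis A B" and "A *v x = b" and "\<And>j. j \<notin> B \<Longrightarrow> x $ j = 0"
  shows "x = basic_solution A b B"
proof -
  define v :: "real^'m" where "v = (\<chi> k. x $ enum B k)"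
  have x: "extend B v = x"
    unfolding v_def using assms is_basis_card by (intro extend_restrict) auto
  have "b = basis_matrix A B *v v"
    using mult_extend[OF is_basis_card[OF assms(1)], where v = v and A = A] assms(2) x by simp
  then have "v = matrix_inv (basis_matrix A B) *v b"
    by (simp add: basis_matrix_inv[OF assms(1)])
  then show ?thesis
    using x by (simp add: basic_solution_def)
qed

lemma supported_kernel_zero:
  assumes "is_basis A B" and "A *v x = 0" and "\<And>j. j \<notin> B \<Longrightarrow> x $ j = 0"
  shows "x = 0"
proof -
  have "x = basic_solution A 0 B"
    by (rule basic_solution_unique[OF assms])
  also have "\<dots> = 0"
    by (rule basic_solution_unique[OF assms(1), symmetric]) auto
  finally show ?thesis .
qed

lemma is_basisI:
  fixes A :: "real^'n^'m"
  assumes card: "card B = CARD('m)"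
    and ker: "\<And>x. A *v x = 0 \<Longrightarrow> (\<And>j. j \<notin> B \<Longrightarrow> x $ j = 0) \<Longrightarrow> x = 0"
  shows "is_basis A B"
proof -
  have "v = 0" if "basis_matrix A B *v v = 0" for v
  proof -
    have "extend B v = 0"
      using that by (intro ker) (auto simp: mult_extend[OF card] extend_outside)
    then have "v $ k = 0" for k
      using extend_enum[OF card, of v k] by simp
    then show ?thesis
      by (simp add: vec_eq_iff)
  qed
  then have "invertible (basis_matrix A B)"
    by (simp add: invertible_left_inverse matrix_left_invertible_ker)
  then show ?thesis
    using card by (simp add: is_basis_def)
qed

lemma is_BFS_feasible: "is_BFS A b x \<Longrightarrow> A *v x = b \<and> 0 \<le> x"
  by (auto simp: is_BFS_def feasible_basis_def mult_basic_solution)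

lemma finite_BFSs: "finite {x. is_BFS (A :: real^'n^'m) b x}"
proof (rule finite_subset)
  show "{x. is_BFS A b x} \<subseteq> range (basic_solution A b)"
    by (auto simp: is_BFS_def)
qed simp

lemma finite_positive_BFS_elements: "finite (positive_BFS_elements (A :: real^'n^'m) b)"
proof (rule finite_subset)
  show "positive_BFS_elements A b \<subseteq> (\<lambda>(x, j). x $ j) ` ({x. is_BFS A b x} \<times> UNIV)"
    by (force simp: positive_BFS_elements_def)
qed (simp add: finite_BFSs)

lemma finite_BFS_values: "finite (BFS_values (A :: real^'n^'m) b c)"
  using finite_imageI[OF finite_BFSs, of "(\<bullet>) c" A b]
  by (simp add: BFS_values_def setcompr_eq_image)

section \<open>Pivots\<close>

text \<open>The edge direction along which the entering variable \<open>j\<close> is increased.\<close>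

definition direction :: "real^'n^'m \<Rightarrow> 'n set \<Rightarrow> 'n \<Rightarrow> real^'n" where
  "direction A B j = axis j 1 - extend B (matrix_inv (basis_matrix A B) *v column j A)"

lemma increase_eq: "increase A b B j \<theta> = basic_solution A b B + \<theta> *\<^sub>R direction A B j"
proof -
  define v where "v = matrix_inv (basis_matrix A B) *v b"
  define w where "w = matrix_inv (basis_matrix A B) *v column j A"
  have "extend B (v - \<theta> *\<^sub>R w) = extend B v - \<theta> *\<^sub>R extend B w"
    using extend_add[of B v "(-\<theta>) *\<^sub>R w"] extend_scaleR[of B "-\<theta>" w] by simp
  then show ?thesis
    unfolding increase_def basic_solution_def direction_def v_def[symmetric] w_def[symmetric]
    by (simp add: algebra_simps)
qed

lemma mult_direction: "is_basis A B \<Longrightarrow> A *v direction A B j = 0"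
  by (simp add: direction_def matrix_vector_mult_diff_distrib mult_extend is_basis_card
      basis_matrix_inv matrix_vector_mul_component matrix_vector_mult_basis)

lemma direction_entering: "j \<notin> B \<Longrightarrow> direction A B j $ j = 1"
  by (simp add: direction_def extend_outside)

lemma direction_outside: "k \<notin> B \<Longrightarrow> k \<noteq> j \<Longrightarrow> direction A B j $ k = 0"
  by (simp add: direction_def extend_outside axis_def)

text \<open>The exchange works because the edge direction has a nonzero entry at the leaving index: a
  kernel vector supported on the new basis is a multiple of the direction, up to a kernel vector
  supported on the old basis, which is 0.\<close>

lemma is_basis_exchange:
  fixes A :: "real^'n^'m"
  assumes B: "is_basis A B" and j: "j \<notin> B" and i: "i \<in> B" and d: "direction A B j $ i \<noteq> 0"
  shows "is_basis A (insert j (B - {i}))"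
proof (rule is_basisI)
  show "card (insert j (B - {i})) = CARD('m)"
    using j i is_basis_card[OF B] by (simp add: card.insert_remove card_gt_0_iff Suc_diff_1)
next
  fix x
  assume ker: "A *v x = 0" and out: "\<And>k. k \<notin> insert j (B - {i}) \<Longrightarrow> x $ k = 0"
  have "x - x $ j *\<^sub>R direction A B j = 0"
  proof (rule supported_kernel_zero[OF B])
    show "A *v (x - x $ j *\<^sub>R direction A B j) = 0"
      by (simp add: matrix_vector_mult_diff_distrib matrix_vector_mult_scaleR ker
          mult_direction[OF B])
    show "(x - x $ j *\<^sub>R direction A B j) $ k = 0" if "k \<notin> B" for k
      using that out[of k] direction_entering[OF j, of A] direction_outside[OF that, of j A]
      by (cases "k = j") auto
  qed
  then have x: "x = x $ j *\<^sub>R direction A B j"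
    by simp
  have "x $ j * direction A B j $ i = 0"
    using arg_cong[OF x, of "\<lambda>x. x $ i"] out[of i] i j by auto
  then show "x = 0"
    using d x by simp
qed

lemma pivot_step:
  fixes A :: "real^'n^'m"
  assumes fb: "feasible_basis A b B" and piv: "pivot A b c B B'"
  obtains j \<theta> where "entering A c B j" and "0 \<le> \<theta>" and "feasible_basis A b B'"
    and "basic_solution A b B' = basic_solution A b B + \<theta> *\<^sub>R direction A B j"
proof -
  let ?x = "basic_solution A b B" and ?d = "\<lambda>j. direction A B j"
  have B: "is_basis A B"
    using fb by (simp add: feasible_basis_def)
  obtain j i where ent: "entering A c B j" and leav: "leaving A b B j i"
    and B': "B' = insert j (B - {i})"
    using piv by (auto simp: pivot_def)
  have j: "j \<notin> B"
    using ent by (simp add: entering_def is_arg_min_def)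
  obtain \<theta> where i: "i \<in> B" and \<theta>: "0 \<le> \<theta>" and pos: "0 \<le> ?x + \<theta> *\<^sub>R ?d j"
    and zero: "?x $ i + \<theta> * ?d j $ i = 0"
    and neg: "\<And>\<theta>'. \<theta>' > \<theta> \<Longrightarrow> ?x $ i + \<theta>' * ?d j $ i < 0"
    using leav by (auto simp: leaving_def increase_eq)
  have "?d j $ i < 0"
    using zero neg[of "\<theta> + 1"] by (simp add: algebra_simps)
  then have bas': "is_basis A B'"
    unfolding B' by (intro is_basis_exchange[OF B j i]) simp
  have sol: "?x + \<theta> *\<^sub>R ?d j = basic_solution A b B'"
  proof (rule basic_solution_unique[OF bas'])
    show "A *v (?x + \<theta> *\<^sub>R ?d j) = b"
      by (simp add: matrix_vector_right_distrib matrix_vector_mult_scaleR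
          mult_direction[OF B] mult_basic_solution[OF B])
    show "(?x + \<theta> *\<^sub>R ?d j) $ k = 0" if "k \<notin> B'" for k
      using that zero basic_solution_outside[of k B A b] direction_outside[of k B j A]
      by (cases "k = i") (auto simp: B')
  qed
  show thesis
    using that[OF ent \<theta> _ sol[symmetric]] pos bas' sol by (simp add: feasible_basis_def)
qed

section \<open>Reduced costs and the decrease of the objective\<close>

lemma reduced_cost_basic:
  fixes A :: "real^'n^'m"
  assumes B: "is_basis A B" and k: "k \<in> B"
  shows "reduced_cost A c B $ k = 0"
proof -
  obtain l :: 'm where l: "k = enum B l"
    using k bij_betw_enum[OF is_basis_card[OF B]] by (auto simp: bij_betw_def)
  have inv: "invertible (transpose (basis_matrix A B))"
    using B by (simp add: is_basis_def transpose_invertible)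
  have "transpose (basis_matrix A B) *v dual_vector A c B = basis_cost c B"
    by (simp add: dual_vector_def matrix_vector_mul_assoc matrix_inv_left_right[OF inv])
  from arg_cong[OF this, of "\<lambda>v. v $ l"] show ?thesis
    by (simp add: reduced_cost_def basis_cost_def basis_matrix_def transpose_def
        matrix_vector_mult_def l)
qed

lemma reduced_cost_basic_solution:
  assumes "is_basis A B"
  shows "reduced_cost A c B \<bullet> basic_solution A b B = 0"
  using reduced_cost_basic[OF assms] basic_solution_outside[of _ B A b]
  by (force simp: inner_vec_def intro!: sum.neutral)

lemma cost_diff_eq_reduced_cost:
  assumes "A *v x = A *v y"
  shows "c \<bullet> x - c \<bullet> y = reduced_cost A c B \<bullet> (x - y)"
proof -
  have "(transpose A *v dual_vector A c B) \<bullet> (x - y) = dual_vector A c B \<bullet> (A *v (x - y))"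
    by (metis dot_lmul_matrix transpose_matrix_vector)
  also have "\<dots> = 0"
    using assms by (simp add: matrix_vector_mult_diff_distrib)
  finally show ?thesis
    by (simp add: reduced_cost_def inner_diff_left inner_diff_right)
qed

text \<open>With \<open>r\<close> the reduced costs of \<open>B\<close>, the excess is the sum of the \<open>-r\<^sub>k x\<^sub>k\<close>, to which only the
  \<open>m\<close> indices in a basis of \<open>x\<close> contribute. The choice of the entering index \<open>j\<close> bounds every
  \<open>-r\<^sub>k\<close> by \<open>-r\<^sub>j / \<parallel>a\<^sub>j\<parallel>\<close> times \<open>\<parallel>a\<^sub>k\<parallel>\<close>.\<close>

lemma excess_le:
  fixes A :: "real^'n^'m"
  assumes B: "is_basis A B" and ent: "entering A c B j"
    and nz: "\<And>k. column k A \<noteq> 0" and M: "\<And>k. norm (column k A) \<le> M"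
    and bfs: "is_BFS A b x" and G: "\<And>k. x $ k \<le> G"
  shows "c \<bullet> basic_solution A b B - c \<bullet> x
    \<le> - (reduced_cost A c B $ j / norm (column j A)) * M * (real CARD('m) * G)"
proof -
  let ?r = "reduced_cost A c B"
  define D where "D = - (?r $ j / norm (column j A))"
  have D: "0 \<le> D"
    using ent by (simp add: D_def entering_def divide_nonpos_nonneg)
  have r: "- ?r $ k \<le> D * M" for k
  proof (cases "k \<in> B")
    case True
    have "0 \<le> M"
      using M[of k] norm_ge_zero order_trans by blast
    then show ?thesis
      using D by (simp add: reduced_cost_basic[OF B True])
  next
    case False
    have "?r $ j / norm (column j A) \<le> ?r $ k / norm (column k A)"
      using ent False unfolding entering_def is_arg_min_def by (meson not_le_imp_less)
    then have "- ?r $ k \<le> D * norm (column k A)"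
      using nz[of k] by (simp add: D_def field_simps)
    also have "\<dots> \<le> D * M"
      using D M by (rule mult_left_mono[rotated])
    finally show ?thesis .
  qed
  obtain C where C: "is_basis A C" and x: "x = basic_solution A b C" and "0 \<le> x"
    using bfs by (auto simp: is_BFS_def feasible_basis_def)
  then have x0: "0 \<le> x $ k" for k
    by (simp add: less_eq_vec_def)
  have DM: "0 \<le> D * M"
    using D M[of j] norm_ge_zero[of "column j A"] by (meson mult_nonneg_nonneg order_trans)
  have "c \<bullet> basic_solution A b B - c \<bullet> x = ?r \<bullet> (basic_solution A b B - x)"
    by (rule cost_diff_eq_reduced_cost) (simp add: mult_basic_solution B C x)
  also have "\<dots> = - (?r \<bullet> x)"
    by (simp add: inner_diff_right reduced_cost_basic_solution[OF B])
  also have "\<dots> = (\<Sum>k\<in>UNIV. - ?r $ k * x $ k)"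
    by (simp add: inner_vec_def sum_negf)
  also have "\<dots> = (\<Sum>k\<in>C. - ?r $ k * x $ k)"
    by (rule sum.mono_neutral_right) (auto simp: x basic_solution_outside)
  also have "\<dots> \<le> (\<Sum>k\<in>C. D * M * G)"
    using r x0 G DM by (intro sum_mono mult_mono) auto
  also have "\<dots> = D * M * (real CARD('m) * G)"
    by (simp add: is_basis_card[OF C])
  finally show ?thesis
    by (simp add: D_def)
qed

text \<open>If the point moves, the increase of the entering variable is a positive entry of the new BFS,
  hence at least \<open>d\<close>. The cost drops by this entry times the reduced cost, and the excess is at
  most a fixed multiple of the same reduced cost.\<close>

lemma pivot_contracts:
  fixes A :: "real^'n^'m"
  assumes fb: "feasible_basis A b B" and piv: "pivot A b c B B'"
    and moves: "basic_solution A b B' \<noteq> basic_solution A b B"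
    and l: "\<And>k. l \<le> norm (column k A)" and l0: "0 < l" and M: "\<And>k. norm (column k A) \<le> M"
    and bfs: "is_BFS A b x" and G: "\<And>k. x $ k \<le> G" and G0: "0 < G"
    and d: "\<And>y k. is_BFS A b y \<Longrightarrow> 0 < y $ k \<Longrightarrow> d \<le> y $ k" and d0: "0 < d"
  shows "c \<bullet> basic_solution A b B' - c \<bullet> x
      \<le> (1 - (l / M) * d / (real CARD('m) * G)) * (c \<bullet> basic_solution A b B - c \<bullet> x)"
    and "c \<bullet> basic_solution A b B' < c \<bullet> basic_solution A b B"
proof -
  let ?x = "basic_solution A b B" and ?x' = "basic_solution A b B'" and ?r = "reduced_cost A c B"
  have B: "is_basis A B"
    using fb by (simp add: feasible_basis_def)
  obtain j \<theta> where ent: "entering A c B j" and \<theta>: "0 \<le> \<theta>" and fb': "feasible_basis A b B'"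
    and x': "?x' = ?x + \<theta> *\<^sub>R direction A B j"
    using pivot_step[OF fb piv] by metis
  have j: "j \<notin> B" and rj: "?r $ j < 0"
    using ent by (simp_all add: entering_def is_arg_min_def)
  have nz: "column k A \<noteq> 0" for k
    using l[of k] l0 by auto
  define D where "D = - (?r $ j / norm (column j A))"
  have D: "0 < D"
    using rj nz[of j] by (simp add: D_def divide_neg_pos)
  have rD: "?r $ j = - (D * norm (column j A))"
    using nz[of j] by (simp add: D_def)
  have M0: "0 < M"
    using l[of j] M[of j] l0 by linarith
  have x'j: "?x' $ j = \<theta>"
    by (simp add: x' basic_solution_outside j direction_entering)
  have "\<theta> \<noteq> 0"
    using moves x' by auto
  then have \<theta>d: "d \<le> \<theta>"
    using d[of ?x' j] fb' \<theta> x'j by (auto simp: is_BFS_def)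
  have "?r \<bullet> direction A B j = (\<Sum>k\<in>UNIV. if k = j then ?r $ k else 0)"
    unfolding inner_vec_def using reduced_cost_basic[OF B] direction_outside[of _ B j A]
    by (intro sum.cong) (auto simp: direction_entering[OF j])
  then have rd: "?r \<bullet> direction A B j = ?r $ j"
    by simp
  have "c \<bullet> ?x' - c \<bullet> ?x = ?r \<bullet> (?x' - ?x)"
    using fb' by (intro cost_diff_eq_reduced_cost)
      (simp add: mult_basic_solution B feasible_basis_def)
  then have drop: "c \<bullet> ?x' - c \<bullet> ?x = - (D * (norm (column j A) * \<theta>))"
    by (simp add: x' rd rD)
  have "l * d \<le> norm (column j A) * \<theta>"
    using l \<theta>d l0 d0 by (intro mult_mono) (auto intro: less_imp_le)
  then have le: "D * (l * d) \<le> D * (norm (column j A) * \<theta>)"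
    using D by simp
  moreover have "0 < D * (l * d)"
    using D l0 d0 by simp
  ultimately show "c \<bullet> ?x' < c \<bullet> ?x"
    using drop by linarith
  let ?q = "(l / M) * d / (real CARD('m) * G)"
  have "0 \<le> ?q"
    using l0 M0 d0 G0 by simp
  then have "?q * (c \<bullet> ?x - c \<bullet> x) \<le> ?q * (D * M * (real CARD('m) * G))"
    using excess_le[OF B ent nz M bfs G] unfolding D_def by (rule mult_left_mono[rotated])
  also have "\<dots> = D * (l * d)"
    using M0 G0 by (simp add: field_simps)
  finally show "c \<bullet> ?x' - c \<bullet> x \<le> (1 - ?q) * (c \<bullet> ?x - c \<bullet> x)"
    using le drop by (simp add: algebra_simps)
qed

section \<open>Counting the points of a geometrically decreasing run\<close>

lemma excess_geometric:
  fixes g :: "'a \<Rightarrow> real" and X :: "nat \<Rightarrow> 'a"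
  assumes q: "0 < q" "q \<le> 1" and g0: "0 \<le> g (X 0)"
    and step: "\<And>t. t < n \<Longrightarrow> X (Suc t) \<noteq> X t \<Longrightarrow> g (X (Suc t)) \<le> (1 - q) * g (X t)"
  shows "g (X n) \<le> (1 - q) ^ card (X ` {..n} - {X 0}) * g (X 0)"
  using step
proof (induction n)
  case (Suc n)
  have IH: "g (X n) \<le> (1 - q) ^ card (X ` {..n} - {X 0}) * g (X 0)"
    using Suc by simp
  show ?case
  proof (cases "X (Suc n) = X n")
    case True
    then have "X ` {..Suc n} = X ` {..n}"
      by (auto simp: atMost_Suc)
    then show ?thesis
      using IH True by simp
  next
    case False
    have "X ` {..Suc n} - {X 0} \<subseteq> insert (X (Suc n)) (X ` {..n} - {X 0})"
      by (auto simp: atMost_Suc)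
    then have "card (X ` {..Suc n} - {X 0}) \<le> card (insert (X (Suc n)) (X ` {..n} - {X 0}))"
      by (intro card_mono) auto
    also have "\<dots> \<le> Suc (card (X ` {..n} - {X 0}))"
      by (rule card_insert_le_m1) auto
    finally have card: "card (X ` {..Suc n} - {X 0}) \<le> Suc (card (X ` {..n} - {X 0}))" .
    have "g (X (Suc n)) \<le> (1 - q) * g (X n)"
      using Suc.prems[of n] False by simp
    also have "\<dots> \<le> (1 - q) * ((1 - q) ^ card (X ` {..n} - {X 0}) * g (X 0))"
      using IH q by (intro mult_left_mono) auto
    also have "\<dots> = (1 - q) ^ Suc (card (X ` {..n} - {X 0})) * g (X 0)"
      by simp
    also have "\<dots> \<le> (1 - q) ^ card (X ` {..Suc n} - {X 0}) * g (X 0)"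
      using q g0 card by (intro mult_right_mono power_decreasing) auto
    finally show ?thesis .
  qed
qed simp

lemma geometric_exponent_le:
  fixes q d g :: real
  assumes "0 < q" "q \<le> 1" "0 < d" and le: "d \<le> (1 - q) ^ k * g"
  shows "real k \<le> ln (g / d) / q"
proof -
  have "0 \<le> (1 - q) ^ k"
    using assms by simp
  then have g: "0 < g"
    using assms by (metis less_le_trans linorder_not_less mult_nonneg_nonpos)
  have "(1 - q) ^ k \<le> exp (- q) ^ k"
    using assms exp_ge_add_one_self[of "- q"] by (intro power_mono) auto
  then have "(1 - q) ^ k * g \<le> exp (- q) ^ k * g"
    using g by simp
  then have "d \<le> exp (- (real k * q)) * g"
    using le by (simp add: exp_of_nat_mult[symmetric])
  then have "exp (real k * q) \<le> g / d"
    using \<open>0 < d\<close> by (simp add: exp_minus field_simps)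
  then have "real k * q \<le> ln (g / d)"
    using g \<open>0 < d\<close> by (simp add: ln_ge_iff)
  then show ?thesis
    using \<open>0 < q\<close> by (simp add: field_simps)
qed

text \<open>The bound \<open>d\<close> is a lower bound for the excess at the points that the sequence moves away from,
  not at the point where it ends. Their geometric decrease is limited by the logarithm, and the
  last point accounts for the summand 1.\<close>

lemma card_new_points_le:
  fixes g :: "'a \<Rightarrow> real" and X :: "nat \<Rightarrow> 'a"
  assumes q: "0 < q" "q \<le> 1" and d: "0 < d" "d \<le> g (X 0)"
    and step: "\<And>t. t < n \<Longrightarrow> X (Suc t) \<noteq> X t \<Longrightarrow> g (X (Suc t)) \<le> (1 - q) * g (X t)"
    and left: "\<And>t. t < n \<Longrightarrow> X (Suc t) \<noteq> X t \<Longrightarrow> d \<le> g (X t)"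
  shows "int (card (X ` {..n} - {X 0})) \<le> \<lfloor>ln (g (X 0) / d) / q\<rfloor> + 1"
  using step left
proof (induction n)
  case 0
  have "0 \<le> ln (g (X 0) / d) / q"
    using q d by simp
  then show ?case
    by simp
next
  case (Suc n)
  show ?case
  proof (cases "X (Suc n) = X n")
    case True
    then have "X ` {..Suc n} = X ` {..n}"
      by (auto simp: atMost_Suc)
    then show ?thesis
      using Suc by simp
  next
    case False
    have "d \<le> g (X n)"
      using Suc.prems(2)[of n] False by simp
    also have "\<dots> \<le> (1 - q) ^ card (X ` {..n} - {X 0}) * g (X 0)"
      using q d Suc.prems(1) by (intro excess_geometric) auto
    finally have "real (card (X ` {..n} - {X 0})) \<le> ln (g (X 0) / d) / q"
      using q d by (intro geometric_exponent_le) auto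
    then have floor: "int (card (X ` {..n} - {X 0})) \<le> \<lfloor>ln (g (X 0) / d) / q\<rfloor>"
      by (simp add: le_floor_iff)
    have "X ` {..Suc n} - {X 0} \<subseteq> insert (X (Suc n)) (X ` {..n} - {X 0})"
      by (auto simp: atMost_Suc)
    then have "card (X ` {..Suc n} - {X 0}) \<le> card (insert (X (Suc n)) (X ` {..n} - {X 0}))"
      by (intro card_mono) auto
    also have "\<dots> \<le> Suc (card (X ` {..n} - {X 0}))"
      by (rule card_insert_le_m1) auto
    finally show ?thesis
      using floor by linarith
  qed
qed

section \<open>The bound for the simplex method\<close>

lemma simplex_run_feasible:
  assumes "simplex_run A b c x0 Bs T" and "enat t \<le> T"
  shows "feasible_basis A b (Bs t)"
  using assms(2)
proof (induction t)
  case 0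
  show ?case
    using assms(1) by (simp add: simplex_run_def)
next
  case (Suc t)
  then have t: "enat t < T"
    by (simp add: Suc_ile_eq)
  then have "pivot A b c (Bs t) (Bs (Suc t))"
    using assms(1) by (simp add: simplex_run_def)
  with Suc.IH t show ?case
    by (meson less_imp_le pivot_step)
qed

theorem theorem3p1:
  fixes A :: "real^'n^'m" and b :: "real^'m" and c x0 xstar xbar sstar :: "real^'n"
    and ystar :: "real^'m" and zstar \<beta> \<gamma> \<delta> :: real
    and Bs :: "nat \<Rightarrow> 'n set" and T :: enat
  assumes "CARD('m) < CARD('n)"
    and "rank A = CARD('m)"
    and "\<forall>j. column j A \<noteq> 0"
    and "is_BFS A b xstar" and "primal_optimal A b c xstar" and "c \<bullet> xstar = zstar"
    and "is_dual_basic_solution A c ystar sstar" and "dual_optimal A b c ystar sstar"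
    and "b \<bullet> ystar = zstar"
    and "is_BFS A b x0" and "c \<bullet> x0 > zstar"
    and "\<gamma> = Max (positive_BFS_elements A b)"
    and "\<delta> = Min (positive_BFS_elements A b)"
    and "\<beta> = (MIN j. norm (column j A)) / (MAX j. norm (column j A))"
    and "second_best_BFS A b c xbar"
    and "simplex_run A b c x0 Bs T"
  shows "finite (generated_BFSs A b x0 Bs T) \<and>
    int (card (generated_BFSs A b x0 Bs T)) \<le>
      strict_ceiling (real CARD('m) * \<gamma> / (\<beta> * \<delta>) *
        ln ((c \<bullet> x0 - zstar) / (c \<bullet> xbar - zstar)))"
proof -
  define X where "X t = basic_solution A b (Bs t)" for t
  define l where "l = (MIN j. norm (column j A))"
  define M where "M = (MAX j. norm (column j A))"
  define P where "P = positive_BFS_elements A b"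
  define g where "g x = c \<bullet> x - c \<bullet> xstar" for x
  note zstar = \<open>c \<bullet> xstar = zstar\<close>
  note run = \<open>simplex_run A b c x0 Bs T\<close>
  have X0: "X 0 = x0"
    using run by (simp add: X_def simplex_run_def)
  have opt: "zstar \<le> c \<bullet> x" if "is_BFS A b x" for x
    using assms(5) is_BFS_feasible[OF that]
    by (auto simp: primal_optimal_def primal_feasible_def zstar[symmetric])

  have l_le: "l \<le> norm (column k A)" and le_M: "norm (column k A) \<le> M" for k
    by (simp_all add: l_def M_def)
  have "l \<in> range (\<lambda>j. norm (column j A))"
    unfolding l_def by (intro Min_in) auto
  then have l0: "0 < l"
    using assms(3) by auto
  have lM: "l \<le> M"
    using l_le le_M order_trans by blast

  \<comment> \<open>The BFSs \<open>x0\<close> and \<open>xstar\<close> have different costs, so one of them is nonzero.\<close>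
  have "x0 \<noteq> xstar"
    using assms(11) zstar by auto
  then obtain k where "x0 $ k \<noteq> xstar $ k"
    by (auto simp: vec_eq_iff)
  moreover have "0 \<le> x0 $ k" "0 \<le> xstar $ k"
    using is_BFS_feasible[OF assms(10)] is_BFS_feasible[OF assms(4)]
    by (auto simp: less_eq_vec_def)
  ultimately have "0 < x0 $ k \<or> 0 < xstar $ k"
    by linarith
  then have P: "finite P" "P \<noteq> {}"
    using assms(4,10) finite_positive_BFS_elements[of A b]
    by (auto simp: P_def positive_BFS_elements_def)
  have P_pos: "0 < p" if "p \<in> P" for p
    using that by (auto simp: P_def positive_BFS_elements_def)
  have \<delta>0: "0 < \<delta>" and \<gamma>0: "0 < \<gamma>" and \<delta>\<gamma>: "\<delta> \<le> \<gamma>"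
    using P Min_in[OF P] Max_in[OF P] P_pos by (auto simp: assms(12,13) P_def[symmetric])
  have \<delta>_le: "\<delta> \<le> y $ k" if "is_BFS A b y" "0 < y $ k" for y k
    using P(1) that
    by (auto simp: assms(13) P_def[symmetric] intro!: Min_le)
      (auto simp: P_def positive_BFS_elements_def)
  have le_\<gamma>: "xstar $ k \<le> \<gamma>" for k
  proof (cases "0 < xstar $ k")
    case True
    then have "xstar $ k \<in> P"
      using assms(4) by (auto simp: P_def positive_BFS_elements_def)
    then show ?thesis
      using P(1) by (simp add: assms(12) P_def[symmetric])
  qed (use \<gamma>0 in linarith)

  define q where "q = (l / M) * \<delta> / (real CARD('m) * \<gamma>)"
  have q0: "0 < q"
    using l0 lM \<delta>0 \<gamma>0 by (simp add: q_def)
  have "(l / M) * \<delta> \<le> 1 * \<gamma>"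
    using l0 lM \<delta>0 \<delta>\<gamma> by (intro mult_mono) auto
  also have "\<dots> \<le> real CARD('m) * \<gamma>"
    using \<gamma>0 by (intro mult_right_mono) (auto simp: Suc_le_eq)
  finally have q1: "q \<le> 1"
    unfolding q_def using \<gamma>0 by (subst divide_le_eq_1_pos) auto

  have fin: "finite (BFS_values A b c)"
    by (rule finite_BFS_values)
  have "Min (BFS_values A b c) = zstar"
  proof (rule Min_eqI[OF fin])
    show "zstar \<in> BFS_values A b c"
      using assms(4) zstar by (auto simp: BFS_values_def)
  qed (use opt in \<open>auto simp: BFS_values_def\<close>)
  then have xbar: "c \<bullet> xbar = Min (BFS_values A b c - {zstar})"
    using assms(15) by (simp add: second_best_BFS_def)
  have gap: "c \<bullet> xbar \<le> c \<bullet> x" if "is_BFS A b x" "zstar < c \<bullet> x" for x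
    unfolding xbar using that fin by (intro Min_le) (auto simp: BFS_values_def)
  have "c \<bullet> x0 \<in> BFS_values A b c - {zstar}"
    using assms(10,11) by (auto simp: BFS_values_def)
  then have "c \<bullet> xbar \<in> BFS_values A b c - {zstar}"
    unfolding xbar using fin by (intro Min_in) auto
  then have xbar_gt: "zstar < c \<bullet> xbar"
    using opt by (force simp: BFS_values_def)

  have bfs: "is_BFS A b (X t)" if "enat t \<le> T" for t
    using simplex_run_feasible[OF run that] by (auto simp: is_BFS_def X_def)
  have contract: "g (X (Suc t)) \<le> (1 - q) * g (X t) \<and> c \<bullet> X (Suc t) < c \<bullet> X t"
    if "enat t < T" "X (Suc t) \<noteq> X t" for t
  proof -
    have fb: "feasible_basis A b (Bs t)"
      using simplex_run_feasible[OF run] that by simp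
    have "pivot A b c (Bs t) (Bs (Suc t))"
      using run that by (simp add: simplex_run_def)
    from pivot_contracts[OF fb this that(2)[unfolded X_def] l_le l0 le_M assms(4) le_\<gamma> \<gamma>0 \<delta>_le \<delta>0]
    show ?thesis
      by (simp add: X_def g_def q_def)
  qed
  have left: "c \<bullet> xbar - zstar \<le> g (X t)" if "enat t < T" "X (Suc t) \<noteq> X t" for t
  proof -
    have "enat (Suc t) \<le> T"
      using that(1) by (simp add: Suc_ile_eq)
    then have "zstar < c \<bullet> X t"
      using contract[OF that] opt[OF bfs] by fastforce
    then show ?thesis
      using gap[OF bfs] that(1) zstar by (simp add: g_def)
  qed

  let ?S = "generated_BFSs A b x0 Bs T"
  have "?S \<subseteq> {x. is_BFS A b x}"
    using bfs by (auto simp: generated_BFSs_def X_def)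
  then have finS: "finite ?S"
    using finite_BFSs finite_subset by blast
  have "?S \<subseteq> X ` {t. enat t \<le> T}"
    by (auto simp: generated_BFSs_def X_def)
  then obtain I where I: "I \<subseteq> {t. enat t \<le> T}" "finite I" "?S = X ` I"
    using finite_subset_image[OF finS] by metis
  \<comment> \<open>As there are finitely many points, all of them occur within finitely many iterations.\<close>
  define n where "n = Max (insert 0 I)"
  have "n \<in> insert 0 I"
    unfolding n_def using I(2) by (intro Max_in) auto
  then have n: "enat n \<le> T"
    using I(1) by (auto simp: zero_enat_def[symmetric])
  have "?S \<subseteq> X ` {..n} - {X 0}"
  proof -
    have "I \<subseteq> {..n}"
      using I(2) by (auto simp: n_def)
    then show ?thesis
      using I(3) by (auto simp: generated_BFSs_def X0)
  qed
  then have "int (card ?S) \<le> int (card (X ` {..n} - {X 0}))"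
    by (intro iffD2[OF of_nat_le_iff] card_mono) auto
  also have "\<dots> \<le> \<lfloor>ln (g (X 0) / (c \<bullet> xbar - zstar)) / q\<rfloor> + 1"
  proof (rule card_new_points_le[OF q0 q1])
    show "c \<bullet> xbar - zstar \<le> g (X 0)"
      using gap[OF assms(10,11)] by (simp add: g_def X0 zstar)
    fix t
    assume "t < n"
    then have t: "enat t < T"
      using n by (meson enat_ord_simps(2) less_le_trans)
    assume "X (Suc t) \<noteq> X t"
    then show "g (X (Suc t)) \<le> (1 - q) * g (X t)" "c \<bullet> xbar - zstar \<le> g (X t)"
      using contract[OF t] left[OF t] by auto
  qed (use xbar_gt in simp)
  also have "ln (g (X 0) / (c \<bullet> xbar - zstar)) / q
      = real CARD('m) * \<gamma> / (\<beta> * \<delta>) * ln ((c \<bullet> x0 - zstar) / (c \<bullet> xbar - zstar))"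
    by (simp add: q_def g_def X0 zstar assms(14) l_def M_def)
  finally show ?thesis
    using finS by (simp add: strict_ceiling_eq)
qed

end
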